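(* Let $\kappa > 0$, let $z_0, \omega_1, \omega_2 \in \mathbb{C}$ with $\omega_1, \omega_2 \neq 0$ and $\omega_1/\omega_2 \notin \mathbb{R}$, and suppose that the shifted lattice $\Lambda = z_0 + \omega_1\mathbb{Z} + \omega_2\mathbb{Z} \subset \mathbb{C}$ is such that $$2\kappa \cdot \frac{|\operatorname{Im}(\omega_1\overline{\omega_2})|}{\min\{|\omega_1|,|\omega_2|\}} \geq \pi.$$ Then, there exist entire functions $f, g : \mathbb{C} \to \mathbb{C}$ of exponential type at most $\kappa$ such that $f \not\sim g$ and $|f| = |g|$ on $\Lambda$.
   Context: Two functions satisfy $f \sim g$ if there exists $\sigma \in \mathbb{C}$ with $|\sigma| = 1$ and $f = \sigma g$; $f \not\sim g$ means that no such $\sigma$ exists. An entire function $f$ is of exponential type at most $\kappa$ if $\limsup_{r \to \infty} r^{-1} \log \max_{|z|=r} |f(z)| \leq \kappa$. The shifted lattice is $z_0 + \omega_1\mathbb{Z} + \omega_2\mathbb{Z} = \{ z_0 + \omega_1 m + \omega_2 n : m,n \in \mathbb{Z} \}$. *)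

theory Defs
  imports "HOL-Complex_Analysis.Complex_Analysis"
begin

definition phase_equiv :: "(complex \<Rightarrow> complex) \<Rightarrow> (complex \<Rightarrow> complex) \<Rightarrow> bool" (infix "\<sim>\<^sub>p" 50)
  where "f \<sim>\<^sub>p g \<longleftrightarrow> (\<exists>\<sigma>::complex. cmod \<sigma> = 1 \<and> f = (\<lambda>z. \<sigma> * g z))"

(* A supremum because Max is meaningful only for finite sets; for r >= 0 and continuous f the
   circle is nonempty and compact, so it is attained. *)
definition max_modulus :: "(complex \<Rightarrow> complex) \<Rightarrow> real \<Rightarrow> real"
  where "max_modulus f r = (SUP z\<in>sphere 0 r. cmod (f z))"

(* The convention log 0 = -\<infinity>, instead of the library's ln 0 = 0, matters for f = 0. *)
definition ext_ln :: "real \<Rightarrow> ereal"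
  where "ext_ln x = (if x = 0 then -\<infinity> else ereal (ln x))"

definition exp_type_at_most :: "(complex \<Rightarrow> complex) \<Rightarrow> real \<Rightarrow> bool"
  where "exp_type_at_most f \<kappa> \<longleftrightarrow>
    Limsup at_top (\<lambda>r::real. ereal (inverse r) * ext_ln (max_modulus f r)) \<le> ereal \<kappa>"

definition shifted_lattice :: "complex \<Rightarrow> complex \<Rightarrow> complex \<Rightarrow> complex set"
  where "shifted_lattice z\<^sub>0 \<omega>\<^sub>1 \<omega>\<^sub>2 = {z\<^sub>0 + \<omega>\<^sub>1 * of_int m + \<omega>\<^sub>2 * of_int n | m n. True}"

end

theory Submission
  imports Defs
begin

text \<open>
  Up to swapping the generators, \<open>\<omega>\<^sub>1\<close> is the shorter one, so the lattice lies on lines parallel to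
  \<open>\<omega>\<^sub>1\<close> at distance \<open>h = \<bar>Im (\<omega>\<^sub>1 * cnj \<omega>\<^sub>2)\<bar> / cmod \<omega>\<^sub>1\<close>. Choose \<open>c\<close> with \<open>cmod c = pi / (2 * h) \<le> \<kappa>\<close>
  such that \<open>u = c * (z - z\<^sub>0)\<close> has imaginary part in \<open>(pi / 2) * \<int>\<close> on these lines. There
  \<open>exp (2 * \<i> * Im u) = \<plusminus>1\<close>, so the cross terms in \<open>\<bar>exp u \<plusminus> \<i> * exp (- u)\<bar>\<^sup>2\<close> vanish, and the two
  functions \<open>exp u \<plusminus> \<i> * exp (- u)\<close> have the same modulus.
\<close>

text \<open>Taking logarithms and dividing by \<open>r\<close>, the bound becomes
  \<open>ln A / r + B\<close>. The factor \<open>A\<close> disappears in the limit, so only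
  \<open>B\<close> counts for the type.\<close>

lemma exp_type_at_mostI:
  assumes "A > 0" "B \<le> \<kappa>" and bound: "\<And>z. cmod (f z) \<le> A * exp (B * cmod z)"
  shows "exp_type_at_most f \<kappa>"
proof -
  have ev: "ereal (inverse r) * ext_ln (max_modulus f r) \<le> ereal (ln A / r + B)" if "r > 0" for r
  \<comment> \<open>If \<open>f\<close> vanishes on the circle, \<open>ext_ln\<close> gives
    \<open>-\<infinity>\<close>, which a positive factor preserves.\<close>
  proof (cases "max_modulus f r = 0")
    case True
    then show ?thesis using that by (simp add: ext_ln_def)
  next
    case False
    have le: "cmod (f z) \<le> A * exp (B * r)" if "z \<in> sphere 0 r" for z
      using bound[of z] that by simp
    \<comment> \<open>This point shows that the circle is nonempty, and its value bounds the
      supremum below by a norm, so a nonzero supremum is positive.\<close>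
    have r: "complex_of_real r \<in> sphere 0 r" using that by simp
    have M_le: "max_modulus f r \<le> A * exp (B * r)"
      unfolding max_modulus_def using r by (intro cSUP_least le) auto
    have "cmod (f r) \<le> max_modulus f r"
      unfolding max_modulus_def by (rule cSUP_upper[OF r]) (meson bdd_aboveI2 le)
    with False have "max_modulus f r > 0"
      using norm_ge_zero[of "f r"] by linarith
    with M_le have "ln (max_modulus f r) \<le> ln (A * exp (B * r))"
      by simp
    also have "\<dots> = ln A + B * r"
      using \<open>A > 0\<close> by (simp add: ln_mult)
    finally show ?thesis
      using False that by (simp add: ext_ln_def field_simps)
  qed
  have "((\<lambda>r. ln A / r + B) \<longlongrightarrow> 0 + B) at_top"
    by (intro tendsto_add tendsto_const tendsto_divide_0[OF tendsto_const]
        filterlim_at_top_imp_at_infinity filterlim_ident)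
  then have lim: "Limsup at_top (\<lambda>r. ereal (ln A / r + B)) = ereal B"
    by (intro lim_imp_Limsup) (auto simp: trivial_limit_at_top_linorder)
  have "Limsup at_top (\<lambda>r. ereal (inverse r) * ext_ln (max_modulus f r))
      \<le> Limsup at_top (\<lambda>r. ereal (ln A / r + B))"
    by (intro Limsup_mono eventually_mono[OF eventually_gt_at_top[of 0]] ev)
  with lim \<open>B \<le> \<kappa>\<close> show ?thesis
    by (simp add: exp_type_at_most_def order_trans)
qed

text \<open>Both exponentials are at most \<open>exp (cmod u)\<close> in modulus, and the shift by
  \<open>z\<^sub>0\<close> only enlarges the constant factor. The coefficient \<open>a\<close> is
  free so that \<open>\<i>\<close> and \<open>- \<i>\<close> are both covered.\<close>

lemma exp_type_exp_combination:
  assumes "cmod c \<le> \<kappa>"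
  shows "exp_type_at_most (\<lambda>z. exp (c * (z - z\<^sub>0)) + a * exp (- (c * (z - z\<^sub>0)))) \<kappa>"
proof (rule exp_type_at_mostI[OF _ assms])
  show "(1 + cmod a) * exp (cmod c * cmod z\<^sub>0) > 0"
    by (simp add: add_pos_nonneg)
  fix z
  let ?u = "c * (z - z\<^sub>0)"
  have "cmod (exp ?u + a * exp (- ?u)) \<le> cmod (exp ?u) + cmod a * cmod (exp (- ?u))"
    by (metis norm_triangle_ineq norm_mult)
  also have "\<dots> \<le> exp (cmod ?u) + cmod a * exp (cmod ?u)"
    using norm_exp[of ?u] norm_exp[of "- ?u"] by (intro add_mono mult_left_mono) simp_all
  also have "\<dots> = (1 + cmod a) * exp (cmod ?u)"
    by (simp add: algebra_simps)
  also have "\<dots> \<le> (1 + cmod a) * exp (cmod c * cmod z\<^sub>0 + cmod c * cmod z)"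
    using mult_left_mono[OF norm_triangle_ineq4[of z z\<^sub>0], of "cmod c"]
    by (intro mult_left_mono) (simp_all add: norm_mult distrib_left add.commute)
  finally show "cmod (exp ?u + a * exp (- ?u))
      \<le> (1 + cmod a) * exp (cmod c * cmod z\<^sub>0) * exp (cmod c * cmod z)"
    by (simp add: exp_add mult.assoc)
qed

lemma cmod_exp_combination_eq:
  assumes "Im u = pi / 2 * of_int k"
  shows "cmod (exp u + \<i> * exp (- u)) = cmod (exp u - \<i> * exp (- u))"
proof -
  \<comment> \<open>The two squared moduli differ by exactly
    \<open>4 * sin (2 * Im u)\<close>.\<close>
  have "sin (2 * Im u) = 0"
    unfolding sin_zero_iff_int2 using assms by (intro exI[of _ k]) (simp add: mult.commute)
  then have "cos (Im u) * sin (Im u) = 0"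
    by (auto simp: sin_double)
  then show ?thesis
    by (auto simp: cmod_def Re_exp Im_exp power2_eq_square algebra_simps)
qed

text \<open>Two values of \<open>u = c * (z - z\<^sub>0)\<close> suffice: \<open>u = 0\<close>
  forces the phase to be \<open>\<i>\<close>, and \<open>u = 1\<close> would then give
  \<open>exp 1 = exp (- 1)\<close>.\<close>

lemma not_phase_equiv_exp_combination:
  assumes "c \<noteq> 0"
  shows "\<not> (\<lambda>z. exp (c * (z - z\<^sub>0)) + \<i> * exp (- (c * (z - z\<^sub>0))))
           \<sim>\<^sub>p (\<lambda>z. exp (c * (z - z\<^sub>0)) - \<i> * exp (- (c * (z - z\<^sub>0))))"
proof
  assume "(\<lambda>z. exp (c * (z - z\<^sub>0)) + \<i> * exp (- (c * (z - z\<^sub>0))))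
           \<sim>\<^sub>p (\<lambda>z. exp (c * (z - z\<^sub>0)) - \<i> * exp (- (c * (z - z\<^sub>0))))"
  then obtain \<sigma> where eq: "exp (c * (z - z\<^sub>0)) + \<i> * exp (- (c * (z - z\<^sub>0)))
      = \<sigma> * (exp (c * (z - z\<^sub>0)) - \<i> * exp (- (c * (z - z\<^sub>0))))" for z
    unfolding phase_equiv_def by meson
  have "1 + \<i> = \<sigma> * (1 - \<i>)"
    using eq[of z\<^sub>0] by simp
  then have "(1 + \<i>) * (1 + \<i>) = \<sigma> * ((1 - \<i>) * (1 + \<i>))"
    by (metis mult.assoc)
  then have "\<sigma> = \<i>"
    by (simp add: complex_eq_iff)
  moreover have "exp 1 + \<i> * exp (- 1) = \<sigma> * (exp 1 - \<i> * exp (- 1))"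
    using eq[of "z\<^sub>0 + 1 / c"] assms by simp
  ultimately have "exp (1 :: real) = exp (- 1)"
    by (simp add: complex_eq_iff Re_exp Im_exp)
  then show False
    by simp
qed

lemma lattice_counterexample:
  assumes "Im (\<omega>\<^sub>1 * cnj \<omega>\<^sub>2) \<noteq> 0"
    and "2 * \<kappa> * (\<bar>Im (\<omega>\<^sub>1 * cnj \<omega>\<^sub>2)\<bar> / cmod \<omega>\<^sub>1) \<ge> pi"
  shows "\<exists>f g :: complex \<Rightarrow> complex.
    f holomorphic_on UNIV \<and> g holomorphic_on UNIV \<and>
    exp_type_at_most f \<kappa> \<and> exp_type_at_most g \<kappa> \<and>
    \<not> f \<sim>\<^sub>p g \<and>
    (\<forall>z \<in> shifted_lattice z\<^sub>0 \<omega>\<^sub>1 \<omega>\<^sub>2. cmod (f z) = cmod (g z))"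
proof -
  define D where "D = Im (\<omega>\<^sub>1 * cnj \<omega>\<^sub>2)"
  have "D \<noteq> 0" "\<omega>\<^sub>1 \<noteq> 0"
    using assms(1) by (auto simp: D_def)
  \<comment> \<open>The factor \<open>cnj \<omega>\<^sub>1\<close> makes the direction of
    \<open>\<omega>\<^sub>1\<close> real. The scaling makes a step by
    \<open>\<omega>\<^sub>2\<close> change \<open>Im u\<close> by \<open>- pi / 2\<close>; keeping
    the sign of \<open>D\<close> avoids a case split.\<close>
  define c where "c = of_real (pi / (2 * D)) * cnj \<omega>\<^sub>1"
  have "c \<noteq> 0"
    using \<open>D \<noteq> 0\<close> \<open>\<omega>\<^sub>1 \<noteq> 0\<close> by (simp add: c_def)
  have "cmod c = pi * cmod \<omega>\<^sub>1 / (2 * \<bar>D\<bar>)"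
    by (simp add: c_def norm_mult norm_divide)
  also have "\<dots> \<le> \<kappa>"
    using assms(2) \<open>D \<noteq> 0\<close> \<open>\<omega>\<^sub>1 \<noteq> 0\<close> unfolding D_def[symmetric] by (simp add: field_simps)
  finally have c_le: "cmod c \<le> \<kappa>" .
  define f where "f = (\<lambda>z. exp (c * (z - z\<^sub>0)) + \<i> * exp (- (c * (z - z\<^sub>0))))"
  define g where "g = (\<lambda>z. exp (c * (z - z\<^sub>0)) - \<i> * exp (- (c * (z - z\<^sub>0))))"
  have "f holomorphic_on UNIV" "g holomorphic_on UNIV"
    unfolding f_def g_def by (intro holomorphic_intros)+
  moreover have "exp_type_at_most f \<kappa>" "exp_type_at_most g \<kappa>"
    using exp_type_exp_combination[OF c_le, of z\<^sub>0 \<i>] exp_type_exp_combination[OF c_le, of z\<^sub>0 "- \<i>"]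
    by (simp_all add: f_def g_def)
  moreover have "\<not> f \<sim>\<^sub>p g"
    using not_phase_equiv_exp_combination[OF \<open>c \<noteq> 0\<close>, of z\<^sub>0] by (simp add: f_def g_def)
  moreover have "cmod (f z) = cmod (g z)" if mem: "z \<in> shifted_lattice z\<^sub>0 \<omega>\<^sub>1 \<omega>\<^sub>2" for z
  proof -
    obtain m n where z: "z = z\<^sub>0 + \<omega>\<^sub>1 * of_int m + \<omega>\<^sub>2 * of_int n"
      using mem by (auto simp: shifted_lattice_def)
    have "Im (cnj \<omega>\<^sub>1 * (z - z\<^sub>0)) = - D * of_int n"
      by (simp add: z D_def algebra_simps)
    moreover have "Im (c * (z - z\<^sub>0)) = pi / (2 * D) * Im (cnj \<omega>\<^sub>1 * (z - z\<^sub>0))"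
      by (simp add: c_def mult.assoc del: minus_complex.sel of_real_divide of_real_mult)
    ultimately have "Im (c * (z - z\<^sub>0)) = pi / 2 * of_int (- n)"
      using \<open>D \<noteq> 0\<close> by simp
    then show ?thesis
      unfolding f_def g_def by (rule cmod_exp_combination_eq)
  qed
  ultimately show ?thesis
    by blast
qed

lemma shifted_lattice_commute:
  "shifted_lattice z\<^sub>0 \<omega>\<^sub>1 \<omega>\<^sub>2 = shifted_lattice z\<^sub>0 \<omega>\<^sub>2 \<omega>\<^sub>1"
  unfolding shifted_lattice_def by (force simp: algebra_simps)

theorem proposition2:
  fixes \<kappa> :: real and z\<^sub>0 \<omega>\<^sub>1 \<omega>\<^sub>2 :: complex
  assumes "\<kappa> > 0"
    and "\<omega>\<^sub>1 \<noteq> 0" and "\<omega>\<^sub>2 \<noteq> 0"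
    and "\<omega>\<^sub>1 / \<omega>\<^sub>2 \<notin> \<real>"
    and "2 * \<kappa> * (\<bar>Im (\<omega>\<^sub>1 * cnj \<omega>\<^sub>2)\<bar> / min (cmod \<omega>\<^sub>1) (cmod \<omega>\<^sub>2)) \<ge> pi"
  shows "\<exists>f g :: complex \<Rightarrow> complex.
    f holomorphic_on UNIV \<and> g holomorphic_on UNIV \<and>
    exp_type_at_most f \<kappa> \<and> exp_type_at_most g \<kappa> \<and>
    \<not> f \<sim>\<^sub>p g \<and>
    (\<forall>z \<in> shifted_lattice z\<^sub>0 \<omega>\<^sub>1 \<omega>\<^sub>2. cmod (f z) = cmod (g z))"
proof -
  \<comment> \<open>Were this zero, the left side of the assumed inequality would be 0, below
    \<open>pi\<close>.\<close>
  have nz: "Im (\<omega>\<^sub>1 * cnj \<omega>\<^sub>2) \<noteq> 0"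
  proof
    assume "Im (\<omega>\<^sub>1 * cnj \<omega>\<^sub>2) = 0"
    with assms(5) have "pi \<le> 0"
      by (simp only: abs_zero div_0 mult_zero_right)
    then show False
      using pi_gt_zero by linarith
  qed
  \<comment> \<open>Exchanging the generators flips only the sign, so the absolute value in the
    inequality is unchanged.\<close>
  have swap: "Im (\<omega>\<^sub>2 * cnj \<omega>\<^sub>1) = - Im (\<omega>\<^sub>1 * cnj \<omega>\<^sub>2)"
    by simp
  show ?thesis
  proof (cases "cmod \<omega>\<^sub>1 \<le> cmod \<omega>\<^sub>2")
    case True
    then show ?thesis
      using assms(5) by (intro lattice_counterexample nz) (simp add: min_absorb1)
  next
    case False
    then show ?thesis
      unfolding shifted_lattice_commute[of z\<^sub>0 \<omega>\<^sub>1] using assms(5) nz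
      by (intro lattice_counterexample) (simp_all only: swap abs_minus_cancel min_absorb2 neg_equal_0_iff_equal
          not_False_eq_True)
  qed
qed

end
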